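(* Let $X$ be a complex Hilbert space and let $T$ and $S$ be Hermitian subspaces in $X^2$ with $D(T)\subset D(S)$ and $S(0)\subset T(0)$. If $S$ is $(T+tS)$-bounded for every $t\in[0,1]$, then $d_+(T+S)=d_+(T)$ and $d_-(T+S)=d_-(T)$.
   Context: A subspace (linear relation) in $X^2=X\times X$ is a linear subspace $T\subset X\times X$, not necessarily closed. Domain: $D(T)=\{x:(x,f)\in T\text{ for some }f\in X\}$; range: $R(T)=\{f:(x,f)\in T\text{ for some }x\in X\}$; $T(x)=\{f\in X:(x,f)\in T\}$. For $\alpha\in\mathbf{C}$, $\alpha T=\{(x,\alpha f):(x,f)\in T\}$; $T+S=\{(x,f+g):(x,f)\in T,(x,g)\in S\}$; $I=\{(x,x):x\in X\}$. The adjoint is $T^*=\{(y,g)\in X^2:\langle g,x\rangle=\langle y,f\rangle\text{ for all }(x,f)\in T\}$. $T$ is Hermitian if $T\subset T^*$ (no density of the domain is assumed). Norm at a point: for $x\in D(T)$, $\|T(x)\|$ is the norm in the quotient space $X/\overline{T(0)}$ of the class of any $f\in T(x)$; equivalently $\|T(x)\|=\mathrm{dist}(f,T(0))$ for any $f\in T(x)$. For subspaces $A,S$ in $X^2$, $S$ is $A$-bounded if $D(A)\subset D(S)$ and there is a constant $c\ge 0$ with $\|S(x)\|\le c(\|x\|+\|A(x)\|)$ for all $x\in D(A)$. Deficiency indices of a Hermitian subspace $T$: $d_{\pm}(T)=\dim R(T\mp iI)^{\perp}$, with values in $\{0,1,2,\dots\}\cup\{+\infty\}$. *)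

theory Defs
  imports "HOL-Analysis.Analysis" "HOL-Library.Extended_Nat"
begin

section \<open>Complex Hilbert spaces\<close>

class complex_vector = real_vector +
  fixes scaleC :: "complex \<Rightarrow> 'a \<Rightarrow> 'a" (infixr "*\<^sub>C" 75)
  assumes scaleC_add_right: "a *\<^sub>C (x + y) = a *\<^sub>C x + a *\<^sub>C y"
    and scaleC_add_left: "(a + b) *\<^sub>C x = a *\<^sub>C x + b *\<^sub>C x"
    and scaleC_scaleC: "a *\<^sub>C (b *\<^sub>C x) = (a * b) *\<^sub>C x"
    and scaleC_one: "1 *\<^sub>C x = x"
    and scaleR_scaleC: "r *\<^sub>R x = complex_of_real r *\<^sub>C x"

global_interpretation complex_vector:
  vector_space "scaleC :: complex \<Rightarrow> 'a \<Rightarrow> 'a::complex_vector"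
  by unfold_locales (simp_all add: scaleC_add_right scaleC_add_left scaleC_scaleC scaleC_one)

text \<open>The inner product is linear in its first argument.\<close>

class complex_inner = complex_vector + real_normed_vector +
  fixes cinner :: "'a \<Rightarrow> 'a \<Rightarrow> complex"
  assumes cinner_commute: "cinner x y = cnj (cinner y x)"
    and cinner_add_left: "cinner (x + y) z = cinner x z + cinner y z"
    and cinner_scaleC_left: "cinner (a *\<^sub>C x) y = a * cinner x y"
    and cinner_self: "cinner x x = complex_of_real ((norm x)\<^sup>2)"

class complex_hilbert_space = complex_inner + complete_space

instantiation complex :: complex_hilbert_space
begin

definition scaleC_complex :: "complex \<Rightarrow> complex \<Rightarrow> complex"
  where "scaleC_complex a x = a * x"

definition cinner_complex :: "complex \<Rightarrow> complex \<Rightarrow> complex"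
  where "cinner_complex x y = x * cnj y"

instance
  by standard
    (simp_all add: scaleC_complex_def cinner_complex_def algebra_simps scaleR_conv_of_real
      flip: complex_norm_square)

end

instantiation prod :: (complex_vector, complex_vector) complex_vector
begin

definition scaleC_prod :: "complex \<Rightarrow> 'a \<times> 'b \<Rightarrow> 'a \<times> 'b"
  where "scaleC_prod a p = (a *\<^sub>C fst p, a *\<^sub>C snd p)"

instance
  by standard
    (simp_all add: scaleC_prod_def scaleC_add_right scaleC_add_left scaleC_scaleC scaleC_one
      scaleR_scaleC scaleR_prod_def)

end

definition orth_complement :: "'a::complex_inner set \<Rightarrow> 'a set"
  where "orth_complement V = {y. \<forall>x\<in>V. cinner x y = 0}"

text \<open>The library's \<open>dim\<close> is \<open>0\<close> on infinite-dimensional spaces; here these get the value \<open>\<infinity>\<close>.\<close>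

definition edim :: "'a::complex_vector set \<Rightarrow> enat"
  where "edim V =
    (if \<exists>B. finite B \<and> V \<subseteq> complex_vector.span B then enat (complex_vector.dim V) else \<infinity>)"

section \<open>Linear relations\<close>

text \<open>
  A subspace in \<open>X \<times> X\<close> is a set \<open>T\<close> of pairs with \<open>complex_vector.subspace T\<close>. Its domain
  \<open>D(T)\<close> is \<open>Domain T\<close>, its range \<open>R(T)\<close> is \<open>Range T\<close>, the set \<open>T(x)\<close> is \<open>T `` {x}\<close>, and the
  identity relation \<open>I\<close> is \<open>Id\<close>.
\<close>

definition rel_scale :: "complex \<Rightarrow> ('a \<times> 'a) set \<Rightarrow> ('a \<times> 'a::complex_vector) set"
  where "rel_scale a T = {(x, a *\<^sub>C f) | x f. (x, f) \<in> T}"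

definition rel_add ::
    "('a \<times> 'a) set \<Rightarrow> ('a \<times> 'a) set \<Rightarrow> ('a \<times> 'a::complex_vector) set"
  where "rel_add T S = {(x, f + g) | x f g. (x, f) \<in> T \<and> (x, g) \<in> S}"

definition rel_adjoint :: "('a \<times> 'a) set \<Rightarrow> ('a \<times> 'a::complex_inner) set"
  where "rel_adjoint T = {(y, g). \<forall>(x, f)\<in>T. cinner g x = cinner y f}"

definition hermitian_subspace :: "('a \<times> 'a::complex_inner) set \<Rightarrow> bool"
  where "hermitian_subspace T \<longleftrightarrow> complex_vector.subspace T \<and> T \<subseteq> rel_adjoint T"

text \<open>The norm of the class of \<open>f\<close> in the quotient of the whole space by a closed subspace \<open>M\<close>.\<close>

definition quotient_norm :: "'a::real_normed_vector set \<Rightarrow> 'a \<Rightarrow> real"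
  where "quotient_norm M f = (INF g\<in>M. norm (f - g))"

text \<open>
  The value does not depend on the choice of \<open>f\<close> in \<open>T(x)\<close>; see \<open>rel_norm_eq\<close> below.
  It is meaningful only for \<open>x\<close> in the domain of \<open>T\<close>.
\<close>

definition rel_norm :: "('a \<times> 'a::real_normed_vector) set \<Rightarrow> 'a \<Rightarrow> real"
  where "rel_norm T x = quotient_norm (closure (T `` {0})) (SOME f. (x, f) \<in> T)"

definition rel_bounded ::
    "('a \<times> 'a) set \<Rightarrow> ('a \<times> 'a::real_normed_vector) set \<Rightarrow> bool"
  where "rel_bounded A S \<longleftrightarrow> Domain A \<subseteq> Domain S \<and>
    (\<exists>c\<ge>0. \<forall>x\<in>Domain A. rel_norm S x \<le> c * (norm x + rel_norm A x))"

definition deficiency_plus :: "('a \<times> 'a::complex_inner) set \<Rightarrow> enat"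
  where "deficiency_plus T = edim (orth_complement (Range (rel_add T (rel_scale (- \<i>) Id))))"

definition deficiency_minus :: "('a \<times> 'a::complex_inner) set \<Rightarrow> enat"
  where "deficiency_minus T = edim (orth_complement (Range (rel_add T (rel_scale \<i> Id))))"

lemma quotient_norm_closure_eq_infdist:
  assumes "M \<noteq> {}"
  shows "quotient_norm (closure M) f = infdist f M"
proof -
  have "quotient_norm (closure M) f = infdist f (closure M)"
    using assms by (simp add: quotient_norm_def infdist_notempty dist_norm)
  also have "\<dots> = infdist f M"
  proof (rule antisym)
    show "infdist f (closure M) \<le> infdist f M"
      using assms closure_subset by (rule infdist_mono[rotated])
    have "infdist f M \<le> dist f g" if "g \<in> closure M" for g
      using infdist_triangle[of f M g] that assms by (simp add: in_closure_iff_infdist_zero)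
    then show "infdist f M \<le> infdist f (closure M)"
      using assms by (auto simp: infdist_notempty[of "closure M"] intro!: cINF_greatest)
  qed
  finally show ?thesis .
qed

lemma rel_norm_eq:
  fixes T :: "('a \<times> 'a::complex_inner) set"
  assumes T: "complex_vector.subspace T" and f: "(x, f) \<in> T"
  shows "rel_norm T x = quotient_norm (closure (T `` {0})) f"
    and "rel_norm T x = infdist f (T `` {0})"
proof -
  define h where "h = (SOME f. (x, f) \<in> T)"
  have h: "(x, h) \<in> T"
    using f unfolding h_def by (rule someI)
  have "(0, 0) \<in> T"
    using complex_vector.subspace_0[OF T] by (simp add: zero_prod_def)
  then have ne: "T `` {0} \<noteq> {}"
    by blast
  have le: "infdist u (T `` {0}) \<le> infdist v (T `` {0})" if "(x, u) \<in> T" "(x, v) \<in> T" for u v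
  proof -
    have "infdist u (T `` {0}) \<le> dist v g" if g: "g \<in> T `` {0}" for g
    proof -
      have "(x, u) - (x, v) + (0, g) \<in> T"
        using g \<open>(x, u) \<in> T\<close> \<open>(x, v) \<in> T\<close>
        by (intro complex_vector.subspace_add[OF T] complex_vector.subspace_diff[OF T]) auto
      then have "infdist u (T `` {0}) \<le> dist u (u - v + g)"
        by (intro infdist_le) simp
      also have "\<dots> = dist v g"
        by (simp add: dist_norm algebra_simps)
      finally show ?thesis .
    qed
    then show ?thesis
      using ne by (auto simp: infdist_notempty[of "T `` {0}" v] intro!: cINF_greatest)
  qed
  have "rel_norm T x = infdist h (T `` {0})"
    using quotient_norm_closure_eq_infdist[OF ne] by (simp add: rel_norm_def h_def)
  also have "\<dots> = infdist f (T `` {0})"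
    using le h f by (intro antisym) auto
  finally show "rel_norm T x = infdist f (T `` {0})" .
  then show "rel_norm T x = quotient_norm (closure (T `` {0})) f"
    using quotient_norm_closure_eq_infdist[OF ne] by simp
qed

end

theory Submission
  imports Defs
begin

text \<open>
  The relations \<open>T + tS\<close>, \<open>0 \<le> t \<le> 1\<close>, connect \<open>T\<close> to \<open>T + S\<close>, and it suffices that each
  deficiency index is locally constant along this path, since \<open>[0, 1]\<close> is connected.

  Fix \<open>t\<close>, a sign \<open>z = \<plusminus>\<i>\<close>, and write \<open>R\<^sub>t\<close> for the range of \<open>T + tS + zI\<close>. For
  \<open>u = h + zx\<close> with \<open>(x, h)\<close> in the Hermitian relation \<open>T + tS\<close> the number \<open>\<langle>h, x\<rangle>\<close> is real, whence
  \<open>\<parallel>u\<parallel>\<^sup>2 = \<parallel>h\<parallel>\<^sup>2 + \<parallel>x\<parallel>\<^sup>2\<close> (\<open>norm_add_imaginary_unit\<close>). Relative boundedness at \<open>t\<close> therefore bounds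
  the class of \<open>S(x)\<close> modulo \<open>S(0)\<close> by a multiple of \<open>\<parallel>u\<parallel>\<close>, and because \<open>S(0) \<subseteq> T(0)\<close> a change of
  the representative \<open>g\<close> of \<open>S(x)\<close> can be absorbed by changing that of \<open>T(x)\<close>
  (\<open>small_representative\<close>). Replacing \<open>t\<close> by a nearby \<open>s\<close> thus moves \<open>u\<close> by \<open>(s - t)g\<close>, which is small
  relative to \<open>\<parallel>u\<parallel>\<close>. So \<open>R\<^sub>t\<close> and \<open>R\<^sub>s\<close> are close in the sense of the gap between subspaces, in both
  directions (\<open>gap_ranges\<close>).

  Finally, if every \<open>v \<in> N\<close> lies within \<open>q\<parallel>v\<parallel>\<close> of \<open>M\<close> for some \<open>q < 1\<close>, then the orthogonal projection
  onto \<open>N\<^sup>\<bottom>\<close> is injective on \<open>M\<^sup>\<bottom>\<close>: a vector \<open>y\<close> of its kernel lies in the closure of \<open>N\<close>, so it is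
  within \<open>q\<parallel>y\<parallel>\<close> of \<open>M\<close>, while its distance from \<open>M\<close> is \<open>\<parallel>y\<parallel>\<close>. Hence \<open>dim M\<^sup>\<bottom> \<le> dim N\<^sup>\<bottom>\<close>
  (\<open>edim_orth_complement_le\<close>).
\<close>

section \<open>Complex inner product spaces\<close>

lemma cinner_add_right: "cinner x (y + z) = cinner x y + cinner x (z :: 'a::complex_inner)"
  by (subst (1 2 3) cinner_commute) (simp add: cinner_add_left)

lemma cinner_scaleC_right: "cinner x (a *\<^sub>C y) = cnj a * cinner x (y :: 'a::complex_inner)"
  by (subst (1 2) cinner_commute) (simp add: cinner_scaleC_left)

lemma cinner_zero_left [simp]: "cinner 0 (x :: 'a::complex_inner) = 0"
  using cinner_add_left[of 0 0 x] by simp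

lemma cinner_zero_right [simp]: "cinner (x :: 'a::complex_inner) 0 = 0"
  using cinner_add_right[of x 0 0] by simp

lemma norm_scaleC: "norm (a *\<^sub>C (x :: 'a::complex_inner)) = cmod a * norm x"
proof -
  have "complex_of_real ((norm (a *\<^sub>C x))\<^sup>2) = complex_of_real ((cmod a * norm x)\<^sup>2)"
    unfolding cinner_self[symmetric] cinner_scaleC_left cinner_scaleC_right
    by (simp add: cinner_self power_mult_distrib complex_norm_square flip: of_real_power)
  then have "(norm (a *\<^sub>C x))\<^sup>2 = (cmod a * norm x)\<^sup>2"
    by (simp only: of_real_eq_iff)
  then show ?thesis
    by (simp add: power2_eq_iff_nonneg)
qed

lemma norm_add_power2:
  "(norm (x + y))\<^sup>2 = (norm x)\<^sup>2 + 2 * Re (cinner x y) + (norm (y :: 'a::complex_inner))\<^sup>2"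
proof -
  have "complex_of_real ((norm (x + y))\<^sup>2)
      = cinner x x + cinner x y + cnj (cinner x y) + cinner y y"
    unfolding cinner_self[symmetric] using cinner_commute[of y x]
    by (simp add: cinner_add_left cinner_add_right algebra_simps)
  then have "Re (complex_of_real ((norm (x + y))\<^sup>2))
      = Re (cinner x x + cinner x y + cnj (cinner x y) + cinner y y)"
    by (rule arg_cong)
  then show ?thesis
    by (simp add: cinner_self)
qed

lemma subspace_closure:
  fixes M :: "'a::complex_inner set"
  assumes "complex_vector.subspace M"
  shows "complex_vector.subspace (closure M)"
proof (rule complex_vector.subspaceI)
  show "0 \<in> closure M"
    using complex_vector.subspace_0[OF assms] closure_subset by blast
next
  fix x y assume "x \<in> closure M" "y \<in> closure M"
  then obtain f g where "\<And>n. f n \<in> M" "f \<longlonglongrightarrow> x" "\<And>n. g n \<in> M" "g \<longlonglongrightarrow> y"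
    unfolding closure_sequential by blast
  then show "x + y \<in> closure M"
    unfolding closure_sequential
    by (intro exI[of _ "\<lambda>n. f n + g n"])
      (auto intro: tendsto_add complex_vector.subspace_add[OF assms])
next
  fix c x assume x: "x \<in> closure M"
  show "c *\<^sub>C x \<in> closure M"
    unfolding closure_approachable
  proof (intro allI impI)
    fix e :: real assume "e > 0"
    then have "e / (cmod c + 1) > 0"
      by (simp add: add_nonneg_pos)
    then obtain m where m: "m \<in> M" "dist m x < e / (cmod c + 1)"
      using x unfolding closure_approachable by blast
    have "dist (c *\<^sub>C m) (c *\<^sub>C x) = cmod c * dist m x"
      by (simp add: dist_norm norm_scaleC flip: complex_vector.scale_right_diff_distrib)
    also have "\<dots> \<le> (cmod c + 1) * dist m x"
      by (simp add: mult_right_mono)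
    also have "\<dots> < e"
      using m(2) by (simp add: pos_less_divide_eq add_nonneg_pos mult.commute)
    finally show "\<exists>y\<in>M. dist y (c *\<^sub>C x) < e"
      using complex_vector.subspace_scale[OF assms m(1)] by blast
  qed
qed

lemma subspace_orth_complement:
  "complex_vector.subspace (orth_complement (M :: 'a::complex_inner set))"
  by (rule complex_vector.subspaceI)
    (auto simp: orth_complement_def cinner_add_right cinner_scaleC_right)

section \<open>Orthogonal projection\<close>

text \<open>
  The parallelogram law makes every minimising sequence Cauchy.
\<close>

lemma closest_point_subspace:
  fixes M :: "'a::complex_hilbert_space set"
  assumes M: "complex_vector.subspace M"
  obtains p where "p \<in> closure M" "norm (y - p) = infdist y M"
proof -
  define d where "d = infdist y M"
  have ne: "M \<noteq> {}"
    using complex_vector.subspace_0[OF M] by auto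
  have d0: "d \<ge> 0"
    by (simp add: d_def infdist_nonneg)
  have "\<exists>m\<in>M. dist y m < d + inverse (real (Suc k))" for k
  proof (rule ccontr)
    assume "\<not> ?thesis"
    then have "d + inverse (real (Suc k)) \<le> infdist y M"
      using ne by (auto simp: infdist_notempty not_less intro!: cINF_greatest)
    then have "inverse (real (Suc k)) \<le> 0"
      unfolding d_def by simp
    then show False
      using inverse_positive_iff_positive[of "real (Suc k)"] by linarith
  qed
  then obtain m where m: "\<And>k. m k \<in> M"
    and md: "\<And>k. norm (y - m k) < d + inverse (real (Suc k))"
    unfolding dist_norm by metis
  \<comment> \<open>The midpoint of \<open>m i\<close> and \<open>m j\<close> lies in \<open>M\<close>, so its distance from \<open>y\<close> is at least \<open>d\<close>.\<close>
  have par: "(norm (m i - m j))\<^sup>2 \<le> 4 * (2 * d + 1) * inverse (real (Suc k))"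
    if "i \<ge> k" "j \<ge> k" for i j k
  proof -
    define e where "e = inverse (real (Suc k))"
    have e: "0 < e" "e \<le> 1"
      by (simp_all add: e_def field_simps)
    have *: "(norm (y - m i))\<^sup>2 \<le> (d + e)\<^sup>2" if "i \<ge> k" for i
    proof (rule power_mono)
      have "inverse (real (Suc i)) \<le> e"
        using that by (simp add: e_def)
      then show "norm (y - m i) \<le> d + e"
        using md[of i] by linarith
    qed simp
    have "(1/2) *\<^sub>C (m i + m j) \<in> M"
      by (intro complex_vector.subspace_scale complex_vector.subspace_add M m)
    then have "d \<le> norm (y - (1/2) *\<^sub>C (m i + m j))"
      unfolding d_def dist_norm[symmetric] by (rule infdist_le)
    moreover have "(y - m i) + (y - m j) = 2 *\<^sub>C (y - (1/2) *\<^sub>C (m i + m j))"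
    proof -
      have "2 *\<^sub>C y = y + y"
        using scaleC_add_left[of 1 1 y] by (simp add: scaleC_one)
      then show ?thesis
        by (simp add: complex_vector.scale_right_diff_distrib scaleC_scaleC scaleC_one
            algebra_simps)
    qed
    ultimately have "2 * d \<le> norm ((y - m i) + (y - m j))"
      by (simp add: norm_scaleC)
    then have "(2 * d)\<^sup>2 \<le> (norm ((y - m i) + (y - m j)))\<^sup>2"
      using d0 by (intro power_mono) auto
    moreover have "(norm ((y - m i) + (y - m j)))\<^sup>2 + (norm (m i - m j))\<^sup>2
        = 2 * (norm (y - m i))\<^sup>2 + 2 * (norm (y - m j))\<^sup>2"
    proof -
      have "m i - m j = (y - m j) + - 1 *\<^sub>C (y - m i)"
        by (simp add: scaleC_one)
      then show ?thesis
        using cinner_commute[of "y - m i" "y - m j"]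
        by (simp only: norm_add_power2 norm_scaleC cinner_scaleC_right) simp
    qed
    ultimately have "(norm (m i - m j))\<^sup>2 \<le> 4 * (d + e)\<^sup>2 - (2 * d)\<^sup>2"
      using *[OF that(1)] *[OF that(2)] by linarith
    also have "\<dots> = 4 * (2 * d + e) * e"
      by (simp add: power2_eq_square algebra_simps)
    also have "\<dots> \<le> 4 * (2 * d + 1) * e"
      using e by (intro mult_right_mono) auto
    finally show ?thesis
      by (simp add: e_def)
  qed
  have "Cauchy m"
    unfolding Cauchy_iff
  proof (intro allI impI)
    fix e :: real assume e: "e > 0"
    have lim: "(\<lambda>k. 4 * (2 * d + 1) * inverse (real (Suc k))) \<longlonglongrightarrow> 4 * (2 * d + 1) * 0"
      by (intro tendsto_intros LIMSEQ_inverse_real_of_nat)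
    have "eventually (\<lambda>k. 4 * (2 * d + 1) * inverse (real (Suc k)) < e\<^sup>2) sequentially"
      by (rule order_tendstoD(2)[OF lim]) (use e in simp)
    then obtain k where "4 * (2 * d + 1) * inverse (real (Suc k)) < e\<^sup>2"
      by (auto simp: eventually_sequentially)
    then have "(norm (m i - m j))\<^sup>2 < e\<^sup>2" if "i \<ge> k" "j \<ge> k" for i j
      using par[OF that] by linarith
    then show "\<exists>k. \<forall>i\<ge>k. \<forall>j\<ge>k. norm (m i - m j) < e"
      using e by (meson less_imp_le power_less_imp_less_base)
  qed
  then obtain p where p: "m \<longlonglongrightarrow> p"
    using Cauchy_convergent convergent_def by blast
  have cl: "p \<in> closure M"
    unfolding closure_sequential using m p by blast
  have "norm (y - p) \<le> d + 0"
  proof (rule tendsto_le)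
    show "(\<lambda>k. d + inverse (real (Suc k))) \<longlonglongrightarrow> d + 0"
      by (intro tendsto_intros LIMSEQ_inverse_real_of_nat)
    show "(\<lambda>k. norm (y - m k)) \<longlonglongrightarrow> norm (y - p)"
      by (intro tendsto_intros p)
  qed (use md in \<open>auto intro: less_imp_le always_eventually\<close>)
  moreover have "d \<le> norm (y - p)"
  proof -
    have "infdist y M \<le> infdist p M + dist y p"
      by (rule infdist_triangle)
    moreover have "infdist p M = 0"
      using cl ne by (simp add: in_closure_iff_infdist_zero)
    ultimately show ?thesis
      by (simp add: d_def dist_norm)
  qed
  ultimately show thesis
    using that[OF cl] by (simp add: d_def)
qed

text \<open>
  Moving from the closest point \<open>p\<close> by a multiple of \<open>n \<in> M\<close> cannot decrease the distance from \<open>y\<close>;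
  the optimal multiple would decrease its square by \<open>|\<langle>y - p, n\<rangle>|\<^sup>2 / \<parallel>n\<parallel>\<^sup>2\<close>.
\<close>

lemma orthogonal_decomposition:
  fixes M :: "'a::complex_hilbert_space set"
  assumes M: "complex_vector.subspace M"
  obtains p where "p \<in> closure M" "y - p \<in> orth_complement M"
proof -
  obtain p where p: "p \<in> closure M" and d: "norm (y - p) = infdist y M"
    using closest_point_subspace[OF M] .
  have ne: "M \<noteq> {}"
    using complex_vector.subspace_0[OF M] by auto
  have "cinner n (y - p) = 0" if n: "n \<in> M" for n
  proof (cases "n = 0")
    case False
    define w where "w = y - p"
    define c where "c = cinner w n"
    define a where "a = - (c / complex_of_real ((norm n)\<^sup>2))"
    have n2: "(norm n)\<^sup>2 > 0"
      using False by simp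
    have "a *\<^sub>C n \<in> closure M"
      using complex_vector.subspace_scale[OF M n] closure_subset by blast
    then have "p - a *\<^sub>C n \<in> closure M"
      by (rule complex_vector.subspace_diff[OF subspace_closure[OF M] p])
    then have "infdist (p - a *\<^sub>C n) M = 0"
      using ne by (simp add: in_closure_iff_infdist_zero)
    then have "norm w \<le> norm (w + a *\<^sub>C n)"
      using infdist_triangle[of y M "p - a *\<^sub>C n"] d
      by (simp add: w_def dist_norm algebra_simps)
    then have "(norm w)\<^sup>2 \<le> (norm (w + a *\<^sub>C n))\<^sup>2"
      by (intro power_mono) auto
    also have "\<dots> = (norm w)\<^sup>2 + 2 * Re (cnj a * c) + (cmod a * norm n)\<^sup>2"
      by (simp add: norm_add_power2 cinner_scaleC_right norm_scaleC c_def)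
    also have "cnj a * c = - complex_of_real ((cmod c)\<^sup>2 / (norm n)\<^sup>2)"
      by (simp add: a_def complex_norm_square del: of_real_power)
    also have "(cmod a * norm n)\<^sup>2 = (cmod c)\<^sup>2 / (norm n)\<^sup>2"
    proof -
      have "cmod a = cmod c / (norm n)\<^sup>2"
        by (simp add: a_def norm_divide norm_power)
      then show ?thesis
        using n2 by (simp add: field_simps power2_eq_square)
    qed
    finally have "(cmod c)\<^sup>2 / (norm n)\<^sup>2 \<le> 0"
      by simp
    then have "c = 0"
      using n2 by (simp add: divide_le_0_iff)
    then show ?thesis
      using cinner_commute[of n w] by (simp add: c_def w_def)
  qed simp
  then show thesis
    using that[OF p] by (simp add: orth_complement_def)
qed

section \<open>Subspaces at small gap\<close>

text \<open>
  The distance of \<open>y\<close> from \<open>M\<close> is \<open>\<parallel>y\<parallel>\<close> by orthogonality and at most \<open>q\<parallel>y\<parallel>\<close> by approximation.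
\<close>

lemma orth_complement_closure_gap:
  fixes M N :: "'a::complex_inner set"
  assumes gap: "\<And>v. v \<in> N \<Longrightarrow> \<exists>u\<in>M. norm (v - u) \<le> q * norm v"
    and q: "0 \<le> q" "q < 1"
    and y: "y \<in> orth_complement M" "y \<in> closure N"
  shows "y = 0"
proof (rule ccontr)
  assume "y \<noteq> 0"
  then have pos: "(1 - q) * norm y > 0"
    using q by simp
  define e where "e = (1 - q) * norm y / 2"
  have "e > 0"
    using pos by (simp add: e_def)
  then obtain v where v: "v \<in> N" "norm (y - v) < e"
    using y(2) unfolding closure_approachable dist_norm by (metis norm_minus_commute)
  obtain u where u: "u \<in> M" "norm (v - u) \<le> q * norm v"
    using gap[OF v(1)] by blast
  have "(norm y)\<^sup>2 \<le> (norm (y + - 1 *\<^sub>C u))\<^sup>2"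
  proof -
    have "cinner y u = 0"
      using y(1) u(1) cinner_commute[of y u] by (simp add: orth_complement_def)
    then show ?thesis
      by (simp only: norm_add_power2 cinner_scaleC_right) simp
  qed
  then have "norm y \<le> norm (y - u)"
    by (simp add: scaleC_one)
  also have "\<dots> \<le> norm (y - v) + norm (v - u)"
    by (rule norm_diff_triangle_ineq[of y v v u, simplified, THEN order_trans])
      (simp add: norm_triangle_ineq)
  also have "\<dots> \<le> norm (y - v) + q * (norm y + norm (y - v))"
  proof -
    have "norm v \<le> norm y + norm (y - v)"
      using norm_triangle_sub[of v y] by (simp add: norm_minus_commute)
    then show ?thesis
      using u(2) mult_left_mono[OF _ q(1)] by fastforce
  qed
  also have "\<dots> \<le> q * norm y + 2 * norm (y - v)"
    using mult_right_mono[of q 1 "norm (y - v)"] q by (simp add: algebra_simps)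
  also have "\<dots> < q * norm y + 2 * e"
    using v by simp
  also have "\<dots> = norm y"
    by (simp add: e_def field_simps)
  finally show False
    by simp
qed

lemma orthogonal_projection_complement:
  fixes N :: "'a::complex_hilbert_space set"
  assumes N: "complex_vector.subspace N"
  obtains Q where "Vector_Spaces.linear scaleC scaleC Q"
    and "\<And>y. Q y \<in> orth_complement N" and "\<And>y. y - Q y \<in> closure N"
proof -
  have "\<exists>w. w \<in> orth_complement N \<and> y - w \<in> closure N" for y
  proof -
    obtain p where "p \<in> closure N" "y - p \<in> orth_complement N"
      using orthogonal_decomposition[OF N] .
    then show ?thesis
      by (intro exI[of _ "y - p"]) simp
  qed
  then obtain Q where Q: "\<And>y. Q y \<in> orth_complement N" "\<And>y. y - Q y \<in> closure N"
    by metis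
  note cl = subspace_closure[OF N] and orth = subspace_orth_complement[of N]
  have unique: "w = w'"
    if "w \<in> orth_complement N" "y - w \<in> closure N"
      and "w' \<in> orth_complement N" "y - w' \<in> closure N" for y w w'
  proof -
    have "w - w' \<in> orth_complement N"
      using that by (intro complex_vector.subspace_diff[OF orth])
    moreover have "(y - w') - (y - w) \<in> closure N"
      by (rule complex_vector.subspace_diff[OF cl that(4,2)])
    then have "w - w' \<in> closure N"
      by simp
    \<comment> \<open>The case of gap \<open>0\<close> says that \<open>N\<^sup>\<bottom>\<close> meets the closure of \<open>N\<close> in \<open>0\<close> only.\<close>
    ultimately have "w - w' = 0"
      by (intro orth_complement_closure_gap[of N N 0]) (auto intro: bexI[of _ v for v])
    then show ?thesis
      by simp
  qed
  have "Vector_Spaces.linear scaleC scaleC Q"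
  proof unfold_locales
    fix x y
    have "(x - Q x) + (y - Q y) \<in> closure N"
      by (intro complex_vector.subspace_add[OF cl] Q)
    then have "(x + y) - (Q x + Q y) \<in> closure N"
      by (simp add: algebra_simps)
    then show "Q (x + y) = Q x + Q y"
      by (intro unique[of _ "x + y"] Q complex_vector.subspace_add[OF orth])
  next
    fix c x
    have "c *\<^sub>C (x - Q x) \<in> closure N"
      by (intro complex_vector.subspace_scale[OF cl] Q)
    then have "c *\<^sub>C x - c *\<^sub>C Q x \<in> closure N"
      by (simp add: complex_vector.scale_right_diff_distrib)
    then show "Q (c *\<^sub>C x) = c *\<^sub>C Q x"
      by (intro unique[of _ "c *\<^sub>C x"] Q complex_vector.subspace_scale[OF orth])
  qed
  then show thesis
    using that Q by blast
qed

lemma edim_le_linear_injection: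
  fixes Q :: "'a::complex_vector \<Rightarrow> 'b::complex_vector"
  assumes Q: "Vector_Spaces.linear scaleC scaleC Q"
    and V: "complex_vector.subspace V" and inj: "inj_on Q V" and img: "Q ` V \<subseteq> W"
  shows "edim V \<le> edim W"
proof (cases "\<exists>B. finite B \<and> W \<subseteq> complex_vector.span B")
  case True
  then obtain B where B: "finite B" "W \<subseteq> complex_vector.span B"
    by blast
  interpret Q: Vector_Spaces.linear "scaleC :: complex \<Rightarrow> 'a \<Rightarrow> 'a" "scaleC :: complex \<Rightarrow> 'b \<Rightarrow> 'b" Q
    by (rule Q)
  obtain C where C: "C \<subseteq> V" "complex_vector.independent C" "V \<subseteq> complex_vector.span C"
      "card C = complex_vector.dim V"
    using complex_vector.basis_exists .
  obtain D where D: "D \<subseteq> W" "complex_vector.independent D" "W \<subseteq> complex_vector.span D"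
      "card D = complex_vector.dim W"
    using complex_vector.basis_exists .
  have finD: "finite D"
    using complex_vector.independent_span_bound[OF B(1) D(2)] D(1) B(2) by blast
  have spanC: "complex_vector.span C = V"
    using complex_vector.span_minimal[OF C(1) V] C(3) by blast
  have injC: "inj_on Q C"
    using inj C(1) by (rule inj_on_subset)
  have "complex_vector.independent (Q ` C)"
    using C(2) inj spanC by (intro Q.independent_injective_image) auto
  moreover have "Q ` C \<subseteq> complex_vector.span D"
    using C(1) img D(3) by blast
  ultimately have "finite (Q ` C)" "card (Q ` C) \<le> card D"
    using complex_vector.independent_span_bound[OF finD] by blast+
  then have "finite C" "card C \<le> card D"
    using injC by (simp_all add: finite_image_iff card_image)
  then show ?thesis
    using True C D by (auto simp: edim_def)
next
  case False
  then have "edim W = \<infinity>"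
    by (simp only: edim_def if_False)
  then show ?thesis
    by simp
qed

lemma edim_orth_complement_le:
  fixes M N :: "'a::complex_hilbert_space set"
  assumes N: "complex_vector.subspace N"
    and gap: "\<And>v. v \<in> N \<Longrightarrow> \<exists>u\<in>M. norm (v - u) \<le> q * norm v"
    and q: "0 \<le> q" "q < 1"
  shows "edim (orth_complement M) \<le> edim (orth_complement N)"
proof -
  obtain Q where Q: "Vector_Spaces.linear scaleC scaleC Q"
    and orth: "\<And>y. Q y \<in> orth_complement N" and cl: "\<And>y. y - Q y \<in> closure N"
    using orthogonal_projection_complement[OF N] by blast
  interpret Q: Vector_Spaces.linear "scaleC :: complex \<Rightarrow> 'a \<Rightarrow> 'a" "scaleC :: complex \<Rightarrow> 'a \<Rightarrow> 'a" Q
    by (rule Q)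
  have "y = 0" if "y \<in> orth_complement M" "Q y = 0" for y
    using orth_complement_closure_gap[OF gap q that(1)] cl[of y] that(2) by simp
  then have "inj_on Q (orth_complement M)"
    by (simp add: Q.inj_on_iff_eq_0 subspace_orth_complement)
  then show ?thesis
    using orth by (intro edim_le_linear_injection[OF Q subspace_orth_complement]) auto
qed

section \<open>The path of perturbed relations\<close>

lemma mem_rel_add_scale:
  "(x, h) \<in> rel_add T (rel_scale a S) \<longleftrightarrow> (\<exists>f g. (x, f) \<in> T \<and> (x, g) \<in> S \<and> h = f + a *\<^sub>C g)"
  by (auto simp: rel_add_def rel_scale_def)

lemma mem_Range_shift:
  "u \<in> Range (rel_add A (rel_scale z Id)) \<longleftrightarrow> (\<exists>x h. (x, h) \<in> A \<and> u = h + z *\<^sub>C x)"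
  by (auto simp: mem_rel_add_scale Range_iff)

lemma subspace_rel_add_scale:
  assumes T: "complex_vector.subspace T" and S: "complex_vector.subspace S"
  shows "complex_vector.subspace (rel_add T (rel_scale a S))"
proof (rule complex_vector.subspaceI)
  show "0 \<in> rel_add T (rel_scale a S)"
    using complex_vector.subspace_0[OF T] complex_vector.subspace_0[OF S]
    by (force simp: zero_prod_def mem_rel_add_scale)
next
  fix p p' assume "p \<in> rel_add T (rel_scale a S)" "p' \<in> rel_add T (rel_scale a S)"
  then obtain x f g x' f' g' where *: "(x, f) \<in> T" "(x, g) \<in> S" "p = (x, f + a *\<^sub>C g)"
      "(x', f') \<in> T" "(x', g') \<in> S" "p' = (x', f' + a *\<^sub>C g')"
    by (cases p, cases p') (auto simp: mem_rel_add_scale)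
  then have "(x + x', f + f') \<in> T" "(x + x', g + g') \<in> S"
    using complex_vector.subspace_add[OF T *(1,4)] complex_vector.subspace_add[OF S *(2,5)]
    by simp_all
  then show "p + p' \<in> rel_add T (rel_scale a S)"
    unfolding * by (force simp: mem_rel_add_scale scaleC_add_right)
next
  fix c p assume "p \<in> rel_add T (rel_scale a S)"
  then obtain x f g where *: "(x, f) \<in> T" "(x, g) \<in> S" "p = (x, f + a *\<^sub>C g)"
    by (cases p) (auto simp: mem_rel_add_scale)
  then have "(c *\<^sub>C x, c *\<^sub>C f) \<in> T" "(c *\<^sub>C x, c *\<^sub>C g) \<in> S"
    using complex_vector.subspace_scale[OF T *(1)] complex_vector.subspace_scale[OF S *(2)]
    by (simp_all add: scaleC_prod_def)
  moreover have "c *\<^sub>C (f + a *\<^sub>C g) = c *\<^sub>C f + a *\<^sub>C (c *\<^sub>C g)"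
    by (simp add: scaleC_add_right scaleC_scaleC mult.commute)
  ultimately show "c *\<^sub>C p \<in> rel_add T (rel_scale a S)"
    unfolding * scaleC_prod_def fst_conv snd_conv mem_rel_add_scale by blast
qed

lemma subspace_Range_shift:
  assumes A: "complex_vector.subspace A"
  shows "complex_vector.subspace (Range (rel_add A (rel_scale z Id)))"
proof (rule complex_vector.subspaceI)
  show "0 \<in> Range (rel_add A (rel_scale z Id))"
    using complex_vector.subspace_0[OF A] by (force simp: mem_Range_shift zero_prod_def)
next
  fix u v assume "u \<in> Range (rel_add A (rel_scale z Id))" "v \<in> Range (rel_add A (rel_scale z Id))"
  then obtain x h y k where "(x, h) \<in> A" "u = h + z *\<^sub>C x" "(y, k) \<in> A" "v = k + z *\<^sub>C y"
    by (auto simp: mem_Range_shift)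
  then have "(x + y, h + k) \<in> A" "u + v = (h + k) + z *\<^sub>C (x + y)"
    using complex_vector.subspace_add[OF A, of "(x, h)" "(y, k)"]
    by (simp_all add: scaleC_add_right)
  then show "u + v \<in> Range (rel_add A (rel_scale z Id))"
    by (auto simp: mem_Range_shift)
next
  fix c u assume "u \<in> Range (rel_add A (rel_scale z Id))"
  then obtain x h where "(x, h) \<in> A" "u = h + z *\<^sub>C x"
    by (auto simp: mem_Range_shift)
  then have "(c *\<^sub>C x, c *\<^sub>C h) \<in> A" "c *\<^sub>C u = c *\<^sub>C h + z *\<^sub>C (c *\<^sub>C x)"
    using complex_vector.subspace_scale[OF A, of "(x, h)" c]
    by (simp_all add: scaleC_prod_def scaleC_add_right scaleC_scaleC mult.commute)
  then show "c *\<^sub>C u \<in> Range (rel_add A (rel_scale z Id))"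
    unfolding mem_Range_shift by blast
qed

lemma hermitian_cinner_real:
  assumes "hermitian_subspace T" "(x, f) \<in> T"
  shows "Im (cinner f x) = 0"
proof -
  have "cinner f x = cinner x f"
    using assms by (auto simp: hermitian_subspace_def rel_adjoint_def)
  then have "cinner f x = cnj (cinner f x)"
    using cinner_commute[of x f] by simp
  then have "Im (cinner f x) = - Im (cinner f x)"
    by (metis cnj.sel(2))
  then show ?thesis
    by simp
qed

text \<open>The cross term is \<open>\<plusminus>2 Im \<langle>h, x\<rangle>\<close>.\<close>

lemma norm_add_imaginary_unit:
  fixes h x :: "'a::complex_inner"
  assumes "Im (cinner h x) = 0" "z \<in> {\<i>, - \<i>}"
  shows "norm h \<le> norm (h + z *\<^sub>C x)" "norm x \<le> norm (h + z *\<^sub>C x)"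
proof -
  have "Re (cinner h (z *\<^sub>C x)) = 0" "norm (z *\<^sub>C x) = norm x"
    using assms by (auto simp: cinner_scaleC_right norm_scaleC)
  then have "(norm (h + z *\<^sub>C x))\<^sup>2 = (norm h)\<^sup>2 + (norm x)\<^sup>2"
    by (simp add: norm_add_power2)
  then have "(norm h)\<^sup>2 \<le> (norm (h + z *\<^sub>C x))\<^sup>2" "(norm x)\<^sup>2 \<le> (norm (h + z *\<^sub>C x))\<^sup>2"
    by simp_all
  then show "norm h \<le> norm (h + z *\<^sub>C x)" "norm x \<le> norm (h + z *\<^sub>C x)"
    using power2_le_imp_le norm_ge_zero by blast+
qed

text \<open>
  The bound on the quotient norm of \<open>S(x)\<close> becomes a bound on an actual element \<open>g\<close> of \<open>S(x)\<close>, chosen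
  without changing the given value \<open>h\<close>: subtracting \<open>g\<^sub>0 \<in> S(0)\<close> from \<open>g\<close> is compensated by adding
  \<open>a g\<^sub>0 \<in> T(0)\<close> to \<open>f\<close>. Two parameters appear because the bound comes from \<open>T + bS\<close>, while both
  the elements of \<open>T + bS\<close> and those of a nearby \<open>T + aS\<close> have to be decomposed in this way.
\<close>

lemma small_representative:
  fixes T S :: "('a \<times> 'a::complex_inner) set"
  assumes T: "complex_vector.subspace T" and S: "complex_vector.subspace S"
    and S0: "S `` {0} \<subseteq> T `` {0}"
    and bd: "rel_bounded (rel_add T (rel_scale b S)) S"
  obtains K where "K > 0"
    and "\<And>a x h. (x, h) \<in> rel_add T (rel_scale a S) \<Longrightarrow>
      \<exists>f g. (x, f) \<in> T \<and> (x, g) \<in> S \<and> h = f + a *\<^sub>C g \<and> norm g \<le> K * (norm x + norm (f + b *\<^sub>C g))"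
proof -
  let ?B = "rel_add T (rel_scale b S)"
  obtain c where c: "c \<ge> 0" "\<And>x. x \<in> Domain ?B \<Longrightarrow> rel_norm S x \<le> c * (norm x + rel_norm ?B x)"
    using bd unfolding rel_bounded_def by blast
  have z: "(0, 0) \<in> T" "(0, 0) \<in> S"
    using complex_vector.subspace_0[OF T] complex_vector.subspace_0[OF S]
    by (simp_all add: zero_prod_def)
  note B = subspace_rel_add_scale[OF T S, of b]
  have "\<exists>f g. (x, f) \<in> T \<and> (x, g) \<in> S \<and> h = f + a *\<^sub>C g
      \<and> norm g \<le> (c + 1) * (norm x + norm (f + b *\<^sub>C g))"
    if xh: "(x, h) \<in> rel_add T (rel_scale a S)" for a x h
  proof -
    obtain f g where fg: "(x, f) \<in> T" "(x, g) \<in> S" "h = f + a *\<^sub>C g"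
      using xh by (auto simp: mem_rel_add_scale)
    have shift: "(x, f + a *\<^sub>C g0) \<in> T \<and> (x, g - g0) \<in> S \<and> h = (f + a *\<^sub>C g0) + a *\<^sub>C (g - g0)"
      if g0: "(0, g0) \<in> S" for g0
    proof -
      have "(0, g0) \<in> T"
        using S0 g0 by blast
      then have "(0, a *\<^sub>C g0) \<in> T"
        using complex_vector.subspace_scale[OF T, of "(0, g0)" a] by (simp add: scaleC_prod_def)
      then show ?thesis
        using complex_vector.subspace_add[OF T fg(1), of "(0, a *\<^sub>C g0)"]
          complex_vector.subspace_diff[OF S fg(2) g0] fg(3)
        by (simp add: complex_vector.scale_right_diff_distrib)
    qed
    \<comment> \<open>For \<open>x = 0\<close> the bound may force \<open>g = 0\<close>, which is possible because then \<open>g \<in> S(0)\<close>.\<close>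
    show ?thesis
    proof (cases "x = 0")
      case True
      then show ?thesis
        using shift[of g] fg z c(1) by (intro exI[of _ "f + a *\<^sub>C g"] exI[of _ 0]) auto
    next
      case False
      have "rel_norm S x = infdist g (S `` {0})"
        by (rule rel_norm_eq(2)[OF S fg(2)])
      \<comment> \<open>As \<open>x \<noteq> 0\<close>, the slack needed to come near the infimum can be \<open>\<parallel>x\<parallel>\<close>, which the bound absorbs.\<close>
      then have "infdist g (S `` {0}) < rel_norm S x + norm x"
        using False by simp
      then obtain g0 where g0: "(0, g0) \<in> S" "dist g g0 < rel_norm S x + norm x"
      proof -
        have "bdd_below (dist g ` (S `` {0}))"
          by (rule bdd_belowI[of _ 0]) auto
        moreover have "S `` {0} \<noteq> {}"
          using z(2) by blast
        ultimately show ?thesis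
          using that \<open>infdist g (S `` {0}) < _\<close> by (auto simp: infdist_notempty cINF_less_iff)
      qed
      define f' g' where "f' = f + a *\<^sub>C g0" and "g' = g - g0"
      have fg': "(x, f') \<in> T" "(x, g') \<in> S" "h = f' + a *\<^sub>C g'"
        using shift[OF g0(1)] by (simp_all add: f'_def g'_def)
      then have xB: "(x, f' + b *\<^sub>C g') \<in> ?B"
        by (auto simp: mem_rel_add_scale)
      have "rel_norm ?B x \<le> norm (f' + b *\<^sub>C g')"
      proof -
        have "0 \<in> ?B `` {0}"
          using complex_vector.subspace_0[OF B] by (simp add: zero_prod_def)
        from infdist_le[OF this, of "f' + b *\<^sub>C g'"] show ?thesis
          by (simp add: rel_norm_eq(2)[OF B xB])
      qed
      then have "c * (norm x + rel_norm ?B x) \<le> c * (norm x + norm (f' + b *\<^sub>C g'))"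
        using c(1) by (intro mult_left_mono) auto
      moreover have "rel_norm S x \<le> c * (norm x + rel_norm ?B x)"
        using c(2) xB by blast
      moreover have "norm g' \<le> rel_norm S x + norm x"
        using g0(2) by (simp add: g'_def dist_norm)
      ultimately have "norm g' \<le> c * (norm x + norm (f' + b *\<^sub>C g')) + norm x"
        by linarith
      also have "\<dots> \<le> (c + 1) * (norm x + norm (f' + b *\<^sub>C g'))"
        by (simp add: algebra_simps)
      finally show ?thesis
        using fg' by blast
    qed
  qed
  then show thesis
    using that[of "c + 1"] c(1) by simp
qed

text \<open>
  With \<open>u \<in> R\<^sub>t\<close> and \<open>v \<in> R\<^sub>s\<close> built from the same \<open>x\<close>, \<open>f\<close>, \<open>g\<close>, one has \<open>v - u = (s - t)g\<close> and
  \<open>\<parallel>g\<parallel> \<le> 2K\<parallel>u\<parallel>\<close>. Asking for \<open>8K|s - t| \<le> 1\<close> makes this difference at most \<open>\<parallel>u\<parallel>/4\<close>, and hence, as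
  \<open>\<parallel>u\<parallel> \<le> \<parallel>v\<parallel> + \<parallel>u\<parallel>/4\<close>, at most \<open>\<parallel>v\<parallel>/3\<close>.
\<close>

lemma gap_ranges:
  fixes T S :: "('a \<times> 'a::complex_inner) set" and t :: real
  defines "R \<equiv> \<lambda>s::real. \<lambda>z.
    Range (rel_add (rel_add T (rel_scale (complex_of_real s) S)) (rel_scale z Id))"
  assumes T: "hermitian_subspace T" and S: "hermitian_subspace S"
    and S0: "S `` {0} \<subseteq> T `` {0}"
    and bd: "rel_bounded (rel_add T (rel_scale (complex_of_real t) S)) S"
    and z: "z \<in> {\<i>, - \<i>}"
  obtains \<delta> where "\<delta> > 0"
    and "\<And>s u. \<bar>s - t\<bar> \<le> \<delta> \<Longrightarrow> u \<in> R t z \<Longrightarrow> \<exists>v\<in>R s z. norm (u - v) \<le> 1/2 * norm u"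
    and "\<And>s v. \<bar>s - t\<bar> \<le> \<delta> \<Longrightarrow> v \<in> R s z \<Longrightarrow> \<exists>u\<in>R t z. norm (v - u) \<le> 1/2 * norm v"
proof -
  have sub: "complex_vector.subspace T" "complex_vector.subspace S"
    using T S by (auto simp: hermitian_subspace_def)
  obtain K where K: "K > 0"
    and rep: "\<And>a x h. (x, h) \<in> rel_add T (rel_scale a S) \<Longrightarrow>
      \<exists>f g. (x, f) \<in> T \<and> (x, g) \<in> S \<and> h = f + a *\<^sub>C g
        \<and> norm g \<le> K * (norm x + norm (f + complex_of_real t *\<^sub>C g))"
    using small_representative[OF sub S0 bd] by blast
  have memR: "(f + complex_of_real s *\<^sub>C g) + z *\<^sub>C x \<in> R s z"
    if "(x, f) \<in> T" "(x, g) \<in> S" for s f g x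
    using that by (auto simp: R_def mem_Range_shift mem_rel_add_scale)
  have close: "norm (((f + complex_of_real s *\<^sub>C g) + z *\<^sub>C x)
        - ((f + complex_of_real t *\<^sub>C g) + z *\<^sub>C x))
      \<le> 1/4 * norm ((f + complex_of_real t *\<^sub>C g) + z *\<^sub>C x)" (is "norm (?v - ?u) \<le> _")
    if fg: "(x, f) \<in> T" "(x, g) \<in> S" "norm g \<le> K * (norm x + norm (f + complex_of_real t *\<^sub>C g))"
      and s: "\<bar>s - t\<bar> \<le> 1 / (8 * K)" for s f g x
  proof -
    have "Im (cinner (f + complex_of_real t *\<^sub>C g) x) = 0"
      using hermitian_cinner_real[OF T fg(1)] hermitian_cinner_real[OF S fg(2)]
      by (simp add: cinner_add_left cinner_scaleC_left)
    from norm_add_imaginary_unit[OF this z]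
    have "norm x + norm (f + complex_of_real t *\<^sub>C g) \<le> 2 * norm ?u"
      by linarith
    then have g: "norm g \<le> K * (2 * norm ?u)"
      using fg(3) K by (meson less_imp_le mult_left_mono order_trans)
    have "?v - ?u = complex_of_real (s - t) *\<^sub>C g"
      by (simp add: complex_vector.scale_left_diff_distrib)
    then have "norm (?v - ?u) = \<bar>s - t\<bar> * norm g"
      by (simp only: norm_scaleC norm_of_real)
    also have "\<dots> \<le> 1 / (8 * K) * (K * (2 * norm ?u))"
      using s K g by (intro mult_mono) auto
    also have "\<dots> = 1/4 * norm ?u"
      using K by simp
    finally show ?thesis .
  qed
  show thesis
  proof (rule that[of "1 / (8 * K)"])
    show "1 / (8 * K) > 0"
      using K by simp
  next
    fix s u assume s: "\<bar>s - t\<bar> \<le> 1 / (8 * K)" and "u \<in> R t z"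
    then obtain x h where "(x, h) \<in> rel_add T (rel_scale (complex_of_real t) S)" "u = h + z *\<^sub>C x"
      by (auto simp: R_def mem_Range_shift)
    with rep obtain f g where fg: "(x, f) \<in> T" "(x, g) \<in> S"
        "norm g \<le> K * (norm x + norm (f + complex_of_real t *\<^sub>C g))"
      and u: "u = (f + complex_of_real t *\<^sub>C g) + z *\<^sub>C x"
      by metis
    let ?v = "(f + complex_of_real s *\<^sub>C g) + z *\<^sub>C x"
    have "norm (?v - u) \<le> 1/4 * norm u"
      unfolding u by (rule close[OF fg s])
    then have "norm (u - ?v) \<le> 1/2 * norm u"
      using norm_ge_zero[of u] unfolding norm_minus_commute[of u] by linarith
    with memR[OF fg(1,2)] show "\<exists>v\<in>R s z. norm (u - v) \<le> 1/2 * norm u" ..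
  next
    fix s v assume s: "\<bar>s - t\<bar> \<le> 1 / (8 * K)" and "v \<in> R s z"
    then obtain x h where "(x, h) \<in> rel_add T (rel_scale (complex_of_real s) S)" "v = h + z *\<^sub>C x"
      by (auto simp: R_def mem_Range_shift)
    with rep obtain f g where fg: "(x, f) \<in> T" "(x, g) \<in> S"
        "norm g \<le> K * (norm x + norm (f + complex_of_real t *\<^sub>C g))"
      and v: "v = (f + complex_of_real s *\<^sub>C g) + z *\<^sub>C x"
      by metis
    let ?u = "(f + complex_of_real t *\<^sub>C g) + z *\<^sub>C x"
    have "norm (v - ?u) \<le> 1/4 * norm ?u"
      unfolding v by (rule close[OF fg s])
    moreover have "norm ?u \<le> norm v + norm (v - ?u)"
      using norm_triangle_sub[of ?u v] by (simp add: norm_minus_commute)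
    ultimately have "norm (v - ?u) \<le> 1/2 * norm v"
      using norm_ge_zero[of v] by linarith
    with memR[OF fg(1,2)] show "\<exists>u\<in>R t z. norm (v - u) \<le> 1/2 * norm v" ..
  qed
qed

section \<open>Invariance of the deficiency indices\<close>

lemma edim_orth_complement_Range_invariant:
  fixes T S :: "('a \<times> 'a::complex_hilbert_space) set"
  assumes T: "hermitian_subspace T" and S: "hermitian_subspace S"
    and dom: "Domain T \<subseteq> Domain S" and S0: "S `` {0} \<subseteq> T `` {0}"
    and bd: "\<And>t::real. t \<in> {0..1} \<Longrightarrow> rel_bounded (rel_add T (rel_scale (complex_of_real t) S)) S"
    and z: "z \<in> {\<i>, - \<i>}"
  shows "edim (orth_complement (Range (rel_add (rel_add T S) (rel_scale z Id))))
    = edim (orth_complement (Range (rel_add T (rel_scale z Id))))"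
proof -
  define R where
    "R s = Range (rel_add (rel_add T (rel_scale (complex_of_real s) S)) (rel_scale z Id))" for s :: real
  define d where "d s = edim (orth_complement (R s))" for s
  have sub: "complex_vector.subspace T" "complex_vector.subspace S"
    using T S by (auto simp: hermitian_subspace_def)
  have R: "complex_vector.subspace (R s)" for s
    unfolding R_def by (intro subspace_Range_shift subspace_rel_add_scale sub)
  have "\<exists>U. openin (top_of_set {0..1}) U \<and> t \<in> U \<and> (\<forall>s\<in>U. d s = d t)" if t: "t \<in> {0..1}" for t
  proof -
    obtain \<delta> where \<delta>: "\<delta> > 0"
      "\<And>s u. \<bar>s - t\<bar> \<le> \<delta> \<Longrightarrow> u \<in> R t \<Longrightarrow> \<exists>v\<in>R s. norm (u - v) \<le> 1/2 * norm u"
      "\<And>s v. \<bar>s - t\<bar> \<le> \<delta> \<Longrightarrow> v \<in> R s \<Longrightarrow> \<exists>u\<in>R t. norm (v - u) \<le> 1/2 * norm v"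
      using gap_ranges[OF T S S0 bd[OF t] z] unfolding R_def by blast
    have "d s = d t" if s: "\<bar>s - t\<bar> \<le> \<delta>" for s
    proof (rule antisym)
      show "d s \<le> d t"
        unfolding d_def by (rule edim_orth_complement_le[OF R \<delta>(2)[OF s]]) simp_all
      show "d t \<le> d s"
        unfolding d_def by (rule edim_orth_complement_le[OF R \<delta>(3)[OF s]]) simp_all
    qed
    then have "\<forall>s \<in> {0..1} \<inter> ball t \<delta>. d s = d t"
      by (auto simp: dist_real_def abs_minus_commute)
    moreover have "openin (top_of_set {0..1}) ({0..1} \<inter> ball t \<delta>)"
      by (simp add: openin_open_Int)
    ultimately show ?thesis
      using t \<delta>(1) by (metis IntI centre_in_ball)
  qed
  then have "d constant_on {0..1}"
    using locally_constant_imp_constant[OF connected_Icc] by blast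
  then have "d 1 = d 0"
    unfolding constant_on_def by (metis atLeastAtMost_iff order_refl zero_le_one)
  moreover have "rel_add T (rel_scale 0 S) = T"
    using dom by (fastforce simp: mem_rel_add_scale)
  moreover have "rel_scale 1 S = S"
    by (auto simp: rel_scale_def scaleC_one)
  ultimately show ?thesis
    by (simp add: d_def R_def)
qed

theorem theorem3p1:
  fixes T S :: "('a \<times> 'a::complex_hilbert_space) set"
  assumes "hermitian_subspace T"
    and "hermitian_subspace S"
    and "Domain T \<subseteq> Domain S"
    and "S `` {0} \<subseteq> T `` {0}"
    and "\<And>t::real. t \<in> {0..1} \<Longrightarrow> rel_bounded (rel_add T (rel_scale (complex_of_real t) S)) S"
  shows "deficiency_plus (rel_add T S) = deficiency_plus T
    \<and> deficiency_minus (rel_add T S) = deficiency_minus T"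
  unfolding deficiency_plus_def deficiency_minus_def
  using edim_orth_complement_Range_invariant[OF assms] by blast

end
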